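(* Let $V=(\mathbb{R}^n,\leq_*,\preccurlyeq_K)$ be the generalized mixed lattice structure on $\mathbb{R}^n$, where $\preccurlyeq_K$ is the partial order defined by a closed convex cone $K$ and $\leq_*$ is the partial order defined by the dual cone $K^*=\{y\in\mathbb{R}^n:\langle x,y\rangle\ge 0\text{ for all }x\in K\}$, such that $K\subseteq K^*$. Then every $x\in V$ can be written as $x=x^{u}-{}^{l}x$, where $x^{u}\succcurlyeq_K 0$, ${}^{l}x\geq_* 0$ and $x^{u}\curlywedge{}^{l}x=0$. Moreover, $x^{u}=0$ if and only if $x\leq_* 0$. (Here $x^u$, ${}^lx$ and $\curlywedge$ are the distinguished elements and the operation fixed in the context.)
   Context: A subset $C$ of a real vector space is called a cone if $tC\subseteq C$ for all $t\ge 0$, $C+C\subseteq C$ and $C\cap(-C)=\{0\}$. Both $K$ and $K^*$ are cones in this sense, so that both determine partial orderings: $x\preccurlyeq_K y$ means $y-x\in K$, and $x\leq_* y$ means $y-x\in K^*$. $\langle\cdot,\cdot\rangle$ is the standard inner product on $\mathbb{R}^n$. For a closed convex set $S$, $P_Sx$ denotes the unique point of $S$ nearest to $x$ in the Euclidean norm. For $x,y\in \mathbb{R}^n$ put $[x\curlyvee y]=\{w: w\succcurlyeq_K x\text{ and }w\geq_* y\}$ and $[x\curlywedge y]=\{w: w\preccurlyeq_K x\text{ and }w\leq_* y\}$. $\mathrm{Min}[x\curlyvee y]$ is the set of minimal elements of $[x\curlyvee y]$ with respect to $\leq_*$, and $\mathrm{Max}[x\curlywedge y]$ is the set of maximal elements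 of $[x\curlywedge y]$ with respect to $\leq_*$. That $V$ is a generalized mixed lattice structure means that $K\subseteq K^*$ and that all the sets $\mathrm{Min}[x\curlyvee y]$ and $\mathrm{Max}[x\curlywedge y]$ are non-empty. Choice of representatives: among the elements of $\mathrm{Min}[0\curlyvee x]$ the element $x^{u}$ is chosen by the criterion of shortest distance, that is, $x^{u}=P_Kx$; and ${}^{l}x$ denotes the corresponding element of $\mathrm{Min}[(-x)\curlyvee 0]$, i.e. the one with $x=x^{u}-{}^{l}x$. With these choices one writes, for $a,b\in\mathbb{R}^n$, $a\curlyvee b=P_{a+K}\,b=a+P_K(b-a)$ and $a\curlywedge b=P_{a-K}\,b$ (single elements, not sets); thus $x^{u}\curlywedge{}^{l}x=0$ means $P_{x^u-K}({}^{l}x)=0$. *)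

theory Defs
  imports "HOL-Analysis.Analysis"
begin

text \<open>Unlike the library's \<^const>\<open>cone\<close>, this notion includes additivity and pointedness;
  such a set is automatically nonempty and convex.\<close>

definition order_cone :: "'a::real_vector set \<Rightarrow> bool" where
  "order_cone C \<longleftrightarrow>
     (\<forall>t\<ge>0. \<forall>x\<in>C. t *\<^sub>R x \<in> C) \<and> (\<forall>x\<in>C. \<forall>y\<in>C. x + y \<in> C) \<and> C \<inter> uminus ` C = {0}"

definition dual_cone :: "'a::real_inner set \<Rightarrow> 'a set" where
  "dual_cone K = {y. \<forall>x\<in>K. x \<bullet> y \<ge> 0}"

definition cone_le :: "'a::real_vector \<Rightarrow> 'a set \<Rightarrow> 'a \<Rightarrow> bool"
    ("(_/ \<preceq>\<^bsub>_\<^esub> _)" [51, 0, 51] 50) where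
  "x \<preceq>\<^bsub>C\<^esub> y \<longleftrightarrow> y - x \<in> C"

definition minimal_elems :: "'a::real_vector set \<Rightarrow> 'a set \<Rightarrow> 'a set" where
  "minimal_elems C S = {w \<in> S. \<forall>v\<in>S. v \<preceq>\<^bsub>C\<^esub> w \<longrightarrow> v = w}"

definition maximal_elems :: "'a::real_vector set \<Rightarrow> 'a set \<Rightarrow> 'a set" where
  "maximal_elems C S = {w \<in> S. \<forall>v\<in>S. w \<preceq>\<^bsub>C\<^esub> v \<longrightarrow> v = w}"

text \<open>The mixed bounds are asymmetric: the first argument is compared with respect to \<open>K\<close>,
  the second one with respect to the dual cone. Minimality and maximality always refer to
  the order of the dual cone.\<close>

definition mixed_upper_bounds :: "'a::real_inner set \<Rightarrow> 'a \<Rightarrow> 'a \<Rightarrow> 'a set" where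
  "mixed_upper_bounds K x y = {w. x \<preceq>\<^bsub>K\<^esub> w \<and> y \<preceq>\<^bsub>dual_cone K\<^esub> w}"

definition mixed_lower_bounds :: "'a::real_inner set \<Rightarrow> 'a \<Rightarrow> 'a \<Rightarrow> 'a set" where
  "mixed_lower_bounds K x y = {w. w \<preceq>\<^bsub>K\<^esub> x \<and> w \<preceq>\<^bsub>dual_cone K\<^esub> y}"

definition Min_upper :: "'a::real_inner set \<Rightarrow> 'a \<Rightarrow> 'a \<Rightarrow> 'a set" where
  "Min_upper K x y = minimal_elems (dual_cone K) (mixed_upper_bounds K x y)"

definition Max_lower :: "'a::real_inner set \<Rightarrow> 'a \<Rightarrow> 'a \<Rightarrow> 'a set" where
  "Max_lower K x y = maximal_elems (dual_cone K) (mixed_lower_bounds K x y)"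

definition generalized_mixed_lattice :: "'a::real_inner set \<Rightarrow> bool" where
  "generalized_mixed_lattice K \<longleftrightarrow>
     K \<subseteq> dual_cone K \<and> (\<forall>x y. Min_upper K x y \<noteq> {} \<and> Max_lower K x y \<noteq> {})"

text \<open>The chosen representative of \<^term>\<open>Min_upper K 0 x\<close>; the lemmas at the end of this theory
  confirm that it belongs to that set and is its point nearest to \<open>x\<close>.\<close>

definition upper_part :: "'a::euclidean_space set \<Rightarrow> 'a \<Rightarrow> 'a" where
  "upper_part K x = closest_point K x"

text \<open>The corresponding element of \<^term>\<open>Min_upper K (-x) 0\<close>. Its existence is not part of
  the definition.\<close>

definition lower_part :: "'a::euclidean_space set \<Rightarrow> 'a \<Rightarrow> 'a" where
  "lower_part K x = (THE w. w \<in> Min_upper K (-x) 0 \<and> x = upper_part K x - w)"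

definition mixed_meet :: "'a::euclidean_space set \<Rightarrow> 'a \<Rightarrow> 'a \<Rightarrow> 'a" where
  "mixed_meet K a b = closest_point ((\<lambda>k. a - k) ` K) b"

lemma upper_part_in_Min_upper:
  fixes K :: "'a::euclidean_space set"
  assumes K: "order_cone K" "closed K"
  shows "upper_part K x \<in> Min_upper K 0 x"
proof -
  define p where "p = closest_point K x"
  have sc: "\<And>t y. t \<ge> 0 \<Longrightarrow> y \<in> K \<Longrightarrow> t *\<^sub>R y \<in> K"
    and ad: "\<And>y z. y \<in> K \<Longrightarrow> z \<in> K \<Longrightarrow> y + z \<in> K" and z: "0 \<in> K"
    using K(1) by (auto simp: order_cone_def)
  have cv: "convex K"
    using sc ad by (auto simp: convex_def)
  have pK: "p \<in> K"
    unfolding p_def using closest_point_in_set K(2) z by blast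
  have vi: "(x - p) \<bullet> (y - p) \<le> 0" if "y \<in> K" for y
    unfolding p_def by (rule closest_point_dot[OF cv K(2) that])
  have d: "y \<bullet> (p - x) \<ge> 0" if "y \<in> K" for y
    using vi[OF ad[OF pK that]] by (simp add: inner_diff_left inner_diff_right inner_commute)
  have o: "p \<bullet> (p - x) = 0"
    using vi[OF z] d[OF pK] by (simp add: inner_diff_left inner_diff_right inner_commute)
  have "w = p" if w: "w \<in> K" "\<forall>y\<in>K. 0 \<le> y \<bullet> (w - x)" "\<forall>y\<in>K. 0 \<le> y \<bullet> (p - w)" for w
  proof -
    have "p \<bullet> (w - x) \<ge> 0" "w \<bullet> (p - w) \<ge> 0"
      using w pK by auto
    then have "(p - w) \<bullet> (p - w) \<le> 0"
      using o by (simp add: inner_diff_left inner_diff_right inner_commute)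
    then show ?thesis
      by (metis inner_eq_zero_iff inner_ge_zero antisym eq_iff_diff_eq_0)
  qed
  then show ?thesis
    using pK d
    by (auto simp: upper_part_def p_def[symmetric] Min_upper_def minimal_elems_def
        mixed_upper_bounds_def cone_le_def dual_cone_def)
qed

lemma upper_part_nearest:
  fixes K :: "'a::euclidean_space set"
  assumes "closed K" "w \<in> Min_upper K 0 x"
  shows "dist x (upper_part K x) \<le> dist x w"
  using assms closest_point_le[of K w x]
  by (auto simp: upper_part_def Min_upper_def minimal_elems_def mixed_upper_bounds_def cone_le_def)

end

theory Submission
  imports Defs
begin

text \<open>Translation by \<open>-x\<close> carries \<open>Min_upper K 0 x\<close> to \<open>Min_upper K (-x) 0\<close>, so \<open>p - x\<close>,
  with \<open>p\<close> the projection of \<open>x\<close> to \<open>K\<close>, is the lower part. The point reflection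
  \<open>k \<mapsto> p - k\<close> takes \<open>x\<close> to \<open>p - x\<close> and \<open>K\<close> to \<open>p - K\<close>; being an isometry, it takes the
  point \<open>p\<close> of \<open>K\<close> nearest to \<open>x\<close> to the point \<open>0\<close> of \<open>p - K\<close> nearest to the lower part.\<close>

text \<open>Both orders depend only on differences, so a common shift preserves mixed bounds and
  minimality.\<close>

lemma Min_upper_translate:
  assumes "w \<in> Min_upper K a b"
  shows "w + c \<in> Min_upper K (a + c) (b + c)"
proof -
  have w: "w \<in> mixed_upper_bounds K a b"
    and min: "\<And>v. v \<in> mixed_upper_bounds K a b \<Longrightarrow> w - v \<in> dual_cone K \<Longrightarrow> v = w"
    using assms by (auto simp: Min_upper_def minimal_elems_def cone_le_def)
  have "v = w + c"
    if "v \<in> mixed_upper_bounds K (a + c) (b + c)" "w + c - v \<in> dual_cone K" for v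
    using min[of "v - c"] that
    by (auto simp: mixed_upper_bounds_def cone_le_def algebra_simps)
  then show ?thesis
    using w by (auto simp: Min_upper_def minimal_elems_def mixed_upper_bounds_def cone_le_def)
qed

lemma lower_part_eq:
  fixes K :: "'a::euclidean_space set"
  assumes "order_cone K" "closed K"
  shows "lower_part K x = upper_part K x - x"
  unfolding lower_part_def
proof (rule the_equality)
  show "upper_part K x - x \<in> Min_upper K (- x) 0 \<and> x = upper_part K x - (upper_part K x - x)"
    using Min_upper_translate[OF upper_part_in_Min_upper[OF assms], of x "- x"] by simp
\<comment> \<open>Uniqueness: the equation \<open>x = upper_part K x - w\<close> already determines
  \<open>w\<close>.\<close>
qed (auto simp: algebra_simps)

lemma closest_point_reflect:
  fixes K :: "'a::euclidean_space set"
  assumes "convex K" "closed K" "K \<noteq> {}"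
  shows "closest_point ((\<lambda>k. a - k) ` K) (a - x) = a - closest_point K x"
proof (rule closest_point_unique[symmetric])
  show "convex ((\<lambda>k. a - k) ` K)"
    using convex_translation[OF convex_negations[OF assms(1)], of a] by (simp add: image_image)
  show "closed ((\<lambda>k. a - k) ` K)"
    using closed_translation[OF closed_negations[OF assms(2)], of a] by (simp add: image_image)
  show "a - closest_point K x \<in> (\<lambda>k. a - k) ` K"
    using closest_point_in_set[OF assms(2,3)] by blast
  show "\<forall>z\<in>(\<lambda>k. a - k) ` K. dist (a - x) (a - closest_point K x) \<le> dist (a - x) z"
    using closest_point_le[OF assms(2)] by (auto simp: dist_norm norm_minus_commute)
qed

text \<open>If \<open>-x\<close> lies in the dual cone, then \<open>0\<close> is itself a mixed
  upper bound of \<open>0\<close> and \<open>x\<close>. It lies below \<open>upper_part K x\<close>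
  because \<open>K \<subseteq> dual_cone K\<close>, so minimality forces equality. Conversely,
  \<open>0\<close> being the upper part makes it a bound of \<open>x\<close>.\<close>

lemma upper_part_eq_0_iff:
  fixes K :: "'a::euclidean_space set"
  assumes "order_cone K" "closed K" "K \<subseteq> dual_cone K"
  shows "upper_part K x = 0 \<longleftrightarrow> x \<preceq>\<^bsub>dual_cone K\<^esub> 0"
proof -
  have "0 \<in> K"
    using assms(1) by (auto simp: order_cone_def)
  then show ?thesis
    using upper_part_in_Min_upper[OF assms(1,2), of x] assms(3)
    by (force simp: Min_upper_def minimal_elems_def mixed_upper_bounds_def cone_le_def)
qed

theorem theorem4p4:
  fixes K :: "(real ^ 'n) set"
  assumes "order_cone K" and "closed K" and "convex K"
    and "order_cone (dual_cone K)"
    and "generalized_mixed_lattice K"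
  shows "\<forall>x. x = upper_part K x - lower_part K x
           \<and> 0 \<preceq>\<^bsub>K\<^esub> upper_part K x
           \<and> 0 \<preceq>\<^bsub>dual_cone K\<^esub> lower_part K x
           \<and> mixed_meet K (upper_part K x) (lower_part K x) = 0
           \<and> (upper_part K x = 0 \<longleftrightarrow> x \<preceq>\<^bsub>dual_cone K\<^esub> 0)"
proof (intro allI conjI)
  fix x
  have low: "lower_part K x = upper_part K x - x"
    by (rule lower_part_eq[OF assms(1,2)])
  show "x = upper_part K x - lower_part K x"
    by (simp add: low)
  show "0 \<preceq>\<^bsub>K\<^esub> upper_part K x" "0 \<preceq>\<^bsub>dual_cone K\<^esub> lower_part K x"
    using upper_part_in_Min_upper[OF assms(1,2), of x]
    by (auto simp: low Min_upper_def minimal_elems_def mixed_upper_bounds_def cone_le_def)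
  have "K \<noteq> {}"
    using assms(1) by (auto simp: order_cone_def)
  then show "mixed_meet K (upper_part K x) (lower_part K x) = 0"
    \<comment> \<open>The centre is chosen so that \<open>a - closest_point K x\<close>
      vanishes.\<close>
    using closest_point_reflect[OF assms(3,2), of "upper_part K x" x]
    by (simp add: low mixed_meet_def upper_part_def)
  show "upper_part K x = 0 \<longleftrightarrow> x \<preceq>\<^bsub>dual_cone K\<^esub> 0"
    using upper_part_eq_0_iff[OF assms(1,2)] assms(5)
    by (simp add: generalized_mixed_lattice_def)
qed

end
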